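(* Let $n\ge 1$ and let $\varphi:M_2(\mathbb{C})\to M_{n+1}(\mathbb{C})$ be a positive linear map whose Choi matrix $\mathbf{H}_\varphi=[\varphi(E_{ij})]_{i,j=1}^2$ has the form $$\mathbf{H}_\varphi=\left[\begin{array}{cc|cc} a&C&x&Y \\ C^*&B&Z^*&T \\ \hline \overline{x}&Z&0&0 \\ Y^*&T^*&0&U\end{array}\right],$$ where $a,x\in\mathbb{C}$, $C,Y,Z\in M_{1,n}(\mathbb{C})$ and $B,T,U\in M_n(\mathbb{C})$. Then the following relations hold: 1. $a\geq 0$ and $B$, $U$ are positive matrices; 2. if $a=0$ then $C=0$, and if $a>0$ then $C^*C\leq aB$; 3. $x=0$; 4. the matrix $\left[\begin{array}{c|c}B&T\\ \hline T^*&U\end{array}\right]\in M_2(M_n(\mathbb{C}))$ is block-positive.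
   Context: "Positive matrix" means positive semidefinite, and $\le$ is the corresponding (Loewner) order on Hermitian matrices. A linear map $\varphi:M_m(\mathbb{C})\to M_k(\mathbb{C})$ is positive if $\varphi(A)$ is positive for every positive $A\in M_m(\mathbb{C})$. $\{E_{ij}\}_{i,j=1}^2$ denotes the standard matrix units of $M_2(\mathbb{C})$. The Choi matrix of a linear map $\varphi:M_2(\mathbb{C})\to M_{n+1}(\mathbb{C})$ is $\mathbf{H}_\varphi=[\varphi(E_{ij})]_{i,j=1}^2\in M_2(M_{n+1}(\mathbb{C}))$. Each of its four blocks, separated by lines in the display, is an $(n+1)\times(n+1)$ matrix written with respect to the splitting $\mathbb{C}^{n+1}=\mathbb{C}\oplus\mathbb{C}^n$ (first standard basis vector, then the remaining $n$). So, for instance, $\varphi(E_{11})=\begin{bmatrix}a&C\\ C^*&B\end{bmatrix}$, $\varphi(E_{12})=\begin{bmatrix}x&Y\\ Z^*&T\end{bmatrix}$, $\varphi(E_{21})=\begin{bmatrix}\overline{x}&Z\\ Y^*&T^*\end{bmatrix}$ and $\varphi(E_{22})=\begin{bmatrix}0&0\\ 0&U\end{bmatrix}$, where $0$ stands for a zero scalar, row or column of the appropriate size. A matrix $[A_{ij}]_{i,j=1}^2\in M_2(M_k(\mathbb{C}))$ is block-positive if $\sum_{i,j=1}^2\overline{\mu_i}\mu_j\langle\xi,A_{ij}\xi\rangle\geq 0$ for all $\mu_1,\mu_2\in\mathbb{C}$ and all $\xi\in\mathbb{C}^k$, where the inner product is conjugate-linear in the first argument. *)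

theory Defs
  imports "Jordan_Normal_Form.Schur_Decomposition"
begin

text \<open>
  Matrices and vectors are those of \<open>Jordan_Normal_Form\<close>, indexed from 0. An element of
  \<open>M\<^sub>2(M\<^sub>k(\<complex>))\<close> is a matrix of matrices, of type \<^typ>\<open>complex mat mat\<close>.
  The order on \<^typ>\<open>complex\<close> is the one of \<open>HOL-Library.Complex_Order\<close>, so that \<open>0 \<le> z\<close> says
  that \<open>z\<close> is real and nonnegative. The inner product \<open>\<langle>\<xi>, \<eta>\<rangle>\<close>, conjugate-linear in its first
  argument, is \<open>\<eta> \<bullet>c \<xi>\<close>.
\<close>

definition hermitian_mat :: "nat \<Rightarrow> complex mat \<Rightarrow> bool" where
  "hermitian_mat k A \<longleftrightarrow> A \<in> carrier_mat k k \<and> mat_adjoint A = A"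

definition positive_mat :: "nat \<Rightarrow> complex mat \<Rightarrow> bool" where
  "positive_mat k A \<longleftrightarrow>
     hermitian_mat k A \<and> (\<forall>\<xi> \<in> carrier_vec k. 0 \<le> (A *\<^sub>v \<xi>) \<bullet>c \<xi>)"

definition loewner_le :: "nat \<Rightarrow> complex mat \<Rightarrow> complex mat \<Rightarrow> bool" where
  "loewner_le k A B \<longleftrightarrow> hermitian_mat k A \<and> hermitian_mat k B \<and> positive_mat k (B - A)"

text \<open>
  A map between matrix spaces is a HOL function of which only the values on
  \<^term>\<open>carrier_mat m m\<close> matter.
\<close>

definition positive_linear_map :: "nat \<Rightarrow> nat \<Rightarrow> (complex mat \<Rightarrow> complex mat) \<Rightarrow> bool" where
  "positive_linear_map m k \<phi> \<longleftrightarrow>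
     linear_map class_ring (module_mat TYPE(complex) m m) (module_mat TYPE(complex) k k) \<phi> \<and>
     (\<forall>A. positive_mat m A \<longrightarrow> positive_mat k (\<phi> A))"

definition matrix_unit :: "nat \<Rightarrow> nat \<Rightarrow> nat \<Rightarrow> complex mat" where
  "matrix_unit m i j = mat m m (\<lambda>(r, s). if r = i \<and> s = j then 1 else 0)"

definition choi_matrix :: "(complex mat \<Rightarrow> complex mat) \<Rightarrow> complex mat mat" where
  "choi_matrix \<phi> = mat 2 2 (\<lambda>(i, j). \<phi> (matrix_unit 2 i j))"

definition block_positive :: "nat \<Rightarrow> complex mat mat \<Rightarrow> bool" where
  "block_positive k A \<longleftrightarrow>
     A \<in> carrier_mat 2 2 \<and> (\<forall>i<2. \<forall>j<2. A $$ (i, j) \<in> carrier_mat k k) \<and>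
     (\<forall>\<mu> :: nat \<Rightarrow> complex. \<forall>\<xi> \<in> carrier_vec k.
        0 \<le> (\<Sum>i<2. \<Sum>j<2. cnj (\<mu> i) * \<mu> j * ((A $$ (i, j) *\<^sub>v \<xi>) \<bullet>c \<xi>)))"

text \<open>
  \<open>bordered_mat a R S B\<close> is the \<open>(n+1) \<times> (n+1)\<close> matrix with scalar corner \<open>a\<close>, row \<open>R\<close>
  (of size \<open>1 \<times> n\<close>), column \<open>S\<close> (of size \<open>n \<times> 1\<close>) and lower right block \<open>B\<close>.
\<close>

definition bordered_mat :: "complex \<Rightarrow> complex mat \<Rightarrow> complex mat \<Rightarrow> complex mat \<Rightarrow> complex mat" where
  "bordered_mat a R S B = four_block_mat (mat 1 1 (\<lambda>_. a)) R S B"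

end

theory Submission
  imports Defs
begin

text \<open>
  Evaluating \<open>\<phi>\<close> on the positive rank-one matrices \<open>[cnj \<mu>\<^sub>i * \<mu>\<^sub>j]\<close> shows that the Choi matrix is
  block-positive. Testing this at vectors \<open>(z, v) \<in> \<complex> \<oplus> \<complex>\<^sup>n\<close> gives everything: \<open>z = 0\<close> yields the
  block-positivity of the compression, while \<open>\<mu> = (1, 0)\<close> and \<open>v = 0\<close> yield nonnegative quadratic
  polynomials in one complex variable, whose discriminant inequalities are \<open>\<bar>C v\<bar>\<^sup>2 \<le> a \<langle>v, B v\<rangle>\<close>
  and \<open>\<bar>x\<bar>\<^sup>2 \<le> a * 0\<close>.
\<close>

section \<open>Nonnegative quadratic polynomials in one complex variable\<close>

lemma complex_quadratic_discriminant:
  fixes a b c :: complex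
  assumes nonneg: "\<And>z. 0 \<le> z * cnj z * a + cnj z * b + z * cnj b + c"
    and a: "0 \<le> a"
  shows "b * cnj b \<le> a * c"
proof (cases "a = 0")
  case True
  have c: "0 \<le> c" using nonneg[of 0] by simp
  have "b = 0"
  proof (rule ccontr)
    assume b: "b \<noteq> 0"
    \<comment> \<open>With \<open>a = 0\<close> the polynomial is affine in \<open>z\<close>, so a
      nonzero \<open>b\<close> makes it unbounded below. This \<open>z\<close> is chosen so that
      \<open>z * cnj b = - (c + 1) / 2\<close>; as \<open>c\<close> is real, the two linear terms
      add up to \<open>- (c + 1)\<close> and the value is -1.\<close>
    define z where "z = - (c + 1) / (2 * cnj b)"
    have "cnj c = c" using c by (auto simp: less_eq_complex_def complex_eq_iff)
    then have "cnj z * b + z * cnj b + c = -1"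
      using b by (simp add: z_def field_simps)
    then show False using nonneg[of z] True by (simp add: less_eq_complex_def)
  qed
  then show ?thesis using True by simp
next
  case False
  have ca: "cnj a = a" using a by (auto simp: less_eq_complex_def complex_eq_iff)
  \<comment> \<open>The minimizer found by completing the square, with minimum
    \<open>c - b * cnj b / a\<close>. Multiplying by \<open>a\<close> then clears the
    denominator.\<close>
  define z where "z = - b / a"
  have "z * cnj z * a + cnj z * b + z * cnj b + c = c - b * cnj b / a"
    using False ca by (simp add: z_def field_simps)
  then have "0 \<le> a * (c - b * cnj b / a)" using nonneg[of z] a by (metis mult_nonneg_nonneg)
  then show ?thesis using False by (simp add: algebra_simps)
qed

section \<open>Adjoints, hermitian matrices and positive rank-one matrices\<close>

lemma mat_adjoint_eq:
  fixes A :: "complex mat"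
  shows "mat_adjoint A = mat (dim_col A) (dim_row A) (\<lambda>(i, j). cnj (A $$ (j, i)))"
  unfolding mat_adjoint_def by (rule eq_matI) (auto simp: mat_of_rows_def)

lemma mat_adjoint_carrier [simp]:
  "(A :: complex mat) \<in> carrier_mat nr nc \<Longrightarrow> mat_adjoint A \<in> carrier_mat nc nr"
  by (auto simp: mat_adjoint_eq)

lemma hermitian_mat_iff:
  "hermitian_mat k A \<longleftrightarrow> A \<in> carrier_mat k k \<and> (\<forall>i<k. \<forall>j<k. cnj (A $$ (j, i)) = A $$ (i, j))"
proof
  assume *: "hermitian_mat k A"
  then have A: "A \<in> carrier_mat k k" and e: "mat_adjoint A = A" by (auto simp: hermitian_mat_def)
  have "cnj (A $$ (j, i)) = A $$ (i, j)" if "i < k" "j < k" for i j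
    using arg_cong[OF e, of "\<lambda>M. M $$ (i, j)"] A that by (simp add: mat_adjoint_eq)
  with A show "A \<in> carrier_mat k k \<and> (\<forall>i<k. \<forall>j<k. cnj (A $$ (j, i)) = A $$ (i, j))" by blast
next
  assume "A \<in> carrier_mat k k \<and> (\<forall>i<k. \<forall>j<k. cnj (A $$ (j, i)) = A $$ (i, j))"
  then show "hermitian_mat k A"
    unfolding hermitian_mat_def mat_adjoint_eq by (auto intro!: eq_matI)
qed

text \<open>The quadratic form at \<open>\<xi>\<close> is the squared modulus of the sum of all
  \<open>\<mu> j * \<xi> $ j\<close>. For \<open>k = 2\<close> these matrices are the arguments of
  \<phi> whose images weight the Choi blocks exactly as block-positivity does.\<close>

lemma positive_mat_rank_one:
  "positive_mat k (mat k k (\<lambda>(i, j). cnj (\<mu> i) * \<mu> j))"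
proof -
  let ?M = "mat k k (\<lambda>(i, j). cnj (\<mu> i) * \<mu> j)"
  have "0 \<le> (?M *\<^sub>v \<xi>) \<bullet>c \<xi>" if "\<xi> \<in> carrier_vec k" for \<xi>
  proof -
    define s where "s = (\<Sum>j<k. \<mu> j * \<xi> $ j)"
    have "(?M *\<^sub>v \<xi>) \<bullet>c \<xi> = (\<Sum>i<k. (\<Sum>j<k. cnj (\<mu> i) * \<mu> j * \<xi> $ j) * cnj (\<xi> $ i))"
      using that by (simp add: scalar_prod_def atLeast0LessThan)
    also have "\<dots> = (\<Sum>i<k. s * (cnj (\<mu> i) * cnj (\<xi> $ i)))"
      unfolding s_def by (simp add: sum_distrib_left sum_distrib_right ac_simps)
    also have "\<dots> = s * cnj s"
      by (simp add: s_def sum_distrib_left)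
    also have "\<dots> \<ge> 0" by (simp add: less_eq_complex_def)
    finally show ?thesis .
  qed
  then show ?thesis by (auto simp: positive_mat_def hermitian_mat_iff)
qed

section \<open>From positive linear maps to block-positive Choi matrices\<close>

lemma sum_lessThan_2: "(\<Sum>i<2. f i) = f 0 + f (1 :: nat)"
  by (simp add: numeral_2_eq_2)

lemma smult_mat_mult_vec:
  fixes A :: "complex mat"
  assumes "A \<in> carrier_mat k l" "v \<in> carrier_vec l"
  shows "(c \<cdot>\<^sub>m A) *\<^sub>v v = c \<cdot>\<^sub>v (A *\<^sub>v v)"
  using assms by (intro eq_vecI) auto

lemma positive_linear_map_add:
  assumes "positive_linear_map m k \<phi>" "A \<in> carrier_mat m m" "B \<in> carrier_mat m m"
  shows "\<phi> (A + B) = \<phi> A + \<phi> B"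
proof -
  interpret linear_map class_ring "module_mat TYPE(complex) m m" "module_mat TYPE(complex) k k" \<phi>
    using assms(1) by (simp add: positive_linear_map_def)
  show ?thesis using assms(2,3) f_add[of A B] by (simp add: module_mat_simps)
qed

lemma positive_linear_map_smult:
  assumes "positive_linear_map m k \<phi>" "A \<in> carrier_mat m m"
  shows "\<phi> (c \<cdot>\<^sub>m A) = c \<cdot>\<^sub>m \<phi> A"
proof -
  interpret linear_map class_ring "module_mat TYPE(complex) m m" "module_mat TYPE(complex) k k" \<phi>
    using assms(1) by (simp add: positive_linear_map_def)
  show ?thesis using assms(2) f_smult[of c A] by (simp add: module_mat_simps class_ring_simps)
qed

lemma positive_linear_map_carrier:
  assumes "positive_linear_map m k \<phi>" "A \<in> carrier_mat m m"
  shows "\<phi> A \<in> carrier_mat k k"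
proof -
  interpret linear_map class_ring "module_mat TYPE(complex) m m" "module_mat TYPE(complex) k k" \<phi>
    using assms(1) by (simp add: positive_linear_map_def)
  show ?thesis using assms(2) f_hom by (auto simp: LinearCombinations.module_hom_def module_mat_simps)
qed

lemma matrix_unit_carrier [simp]: "matrix_unit m i j \<in> carrier_mat m m"
  by (simp add: matrix_unit_def)

text \<open>The rank-one case with an indicator function for \<open>\<mu>\<close>. It makes the
  diagonal Choi blocks positive, and in particular hermitian.\<close>

lemma positive_mat_matrix_unit_diag:
  assumes "i < m"
  shows "positive_mat m (matrix_unit m i i)"
proof -
  have "matrix_unit m i i =
      mat m m (\<lambda>(r, s). cnj ((\<lambda>l. of_bool (l = i)) r) * (\<lambda>l. of_bool (l = i)) s)"
    by (auto simp: matrix_unit_def)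
  then show ?thesis using positive_mat_rank_one by metis
qed

lemma block_positive_choi_matrix:
  assumes pos: "positive_linear_map 2 k \<phi>"
  shows "block_positive k (choi_matrix \<phi>)"
proof -
  let ?E = "matrix_unit 2"
  have car [simp]: "\<phi> (?E i j) \<in> carrier_mat k k" for i j
    using positive_linear_map_carrier[OF pos] by simp
  have "0 \<le> (\<Sum>i<2. \<Sum>j<2. cnj (\<mu> i) * \<mu> j * ((choi_matrix \<phi> $$ (i, j) *\<^sub>v \<xi>) \<bullet>c \<xi>))"
    if \<xi>: "\<xi> \<in> carrier_vec k" for \<mu> \<xi>
  proof -
    let ?w = "\<lambda>i j. cnj (\<mu> i) * \<mu> j"
    let ?M = "mat 2 2 (\<lambda>(i, j). ?w i j)"
    \<comment> \<open>Expanding in matrix units lets linearity reach the Choi blocks. The grouping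
      two by two matches the nested sum over \<open>i\<close> and \<open>j\<close>.\<close>
    have "?M = (?w 0 0 \<cdot>\<^sub>m ?E 0 0 + ?w 0 1 \<cdot>\<^sub>m ?E 0 1) + (?w 1 0 \<cdot>\<^sub>m ?E 1 0 + ?w 1 1 \<cdot>\<^sub>m ?E 1 1)"
      by (rule eq_matI) (auto simp: matrix_unit_def less_2_cases_iff)
    then have "\<phi> ?M = (?w 0 0 \<cdot>\<^sub>m \<phi> (?E 0 0) + ?w 0 1 \<cdot>\<^sub>m \<phi> (?E 0 1))
        + (?w 1 0 \<cdot>\<^sub>m \<phi> (?E 1 0) + ?w 1 1 \<cdot>\<^sub>m \<phi> (?E 1 1))"
      by (simp add: positive_linear_map_add[OF pos] positive_linear_map_smult[OF pos])
    then have "(\<phi> ?M *\<^sub>v \<xi>) \<bullet>c \<xi> =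
        (\<Sum>i<2. \<Sum>j<2. cnj (\<mu> i) * \<mu> j * ((choi_matrix \<phi> $$ (i, j) *\<^sub>v \<xi>) \<bullet>c \<xi>))"
      using \<xi> by (simp add: add_mult_distrib_mat_vec[of _ k k] smult_mat_mult_vec[of _ k k]
          add_scalar_prod_distrib[of _ k]
          smult_scalar_prod_distrib[of _ k] mult_mat_vec_carrier[of _ k k] sum_lessThan_2 choi_matrix_def)
    moreover have "positive_mat k (\<phi> ?M)"
      using pos positive_mat_rank_one[of 2 \<mu>] by (simp add: positive_linear_map_def)
    ultimately show ?thesis using \<xi> by (auto simp: positive_mat_def)
  qed
  then show ?thesis by (auto simp: block_positive_def choi_matrix_def)
qed

section \<open>Bordered matrices and row matrices\<close>

lemma bordered_mat_form:
  fixes z :: complex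
  assumes R: "R \<in> carrier_mat 1 n" and S: "S \<in> carrier_mat 1 n"
    and B: "B \<in> carrier_mat n n" and v: "v \<in> carrier_vec n"
  defines "\<xi> \<equiv> vec 1 (\<lambda>_. z) @\<^sub>v v"
  shows "(bordered_mat a R (mat_adjoint S) B *\<^sub>v \<xi>) \<bullet>c \<xi> =
    z * cnj z * a + cnj z * (row R 0 \<bullet> v) + z * cnj (row S 0 \<bullet> v) + (B *\<^sub>v v) \<bullet>c v"
proof -
  have conj: "conjugate \<xi> = vec 1 (\<lambda>_. cnj z) @\<^sub>v conjugate v"
    using v by (intro eq_vecI) (auto simp: \<xi>_def)
  have "bordered_mat a R (mat_adjoint S) B *\<^sub>v \<xi> =
      (mat 1 1 (\<lambda>_. a) *\<^sub>v vec 1 (\<lambda>_. z) + R *\<^sub>v v) @\<^sub>v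
      (mat_adjoint S *\<^sub>v vec 1 (\<lambda>_. z) + B *\<^sub>v v)"
    unfolding bordered_mat_def \<xi>_def
    by (rule four_block_mat_mult_vec[of _ 1 1 _ n _ n]) (use R S B v in auto)
  moreover have "(p @\<^sub>v q) \<bullet>c \<xi> = p \<bullet> vec 1 (\<lambda>_. cnj z) + q \<bullet>c v"
    if "p \<in> carrier_vec 1" "q \<in> carrier_vec n" for p q :: "complex vec"
    unfolding conj by (rule scalar_prod_append) (use that v in auto)
  moreover have "mat 1 1 (\<lambda>_. a) *\<^sub>v vec 1 (\<lambda>_. z) + R *\<^sub>v v \<in> carrier_vec 1"
    "mat_adjoint S *\<^sub>v vec 1 (\<lambda>_. z) + B *\<^sub>v v \<in> carrier_vec n"
    using R S B v by (auto intro!: carrier_vecI simp: mat_adjoint_eq)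
  ultimately have "(bordered_mat a R (mat_adjoint S) B *\<^sub>v \<xi>) \<bullet>c \<xi> =
      (mat 1 1 (\<lambda>_. a) *\<^sub>v vec 1 (\<lambda>_. z) + R *\<^sub>v v) \<bullet> vec 1 (\<lambda>_. cnj z) +
      (mat_adjoint S *\<^sub>v vec 1 (\<lambda>_. z) + B *\<^sub>v v) \<bullet>c v"
    by metis
  moreover have "(mat 1 1 (\<lambda>_. a) *\<^sub>v vec 1 (\<lambda>_. z) + R *\<^sub>v v) \<bullet> vec 1 (\<lambda>_. cnj z) =
      z * cnj z * a + cnj z * (row R 0 \<bullet> v)"
    using R by (simp add: scalar_prod_def algebra_simps)
  moreover have "(mat_adjoint S *\<^sub>v vec 1 (\<lambda>_. z) + B *\<^sub>v v) \<bullet>c v =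
      (mat_adjoint S *\<^sub>v vec 1 (\<lambda>_. z)) \<bullet>c v + (B *\<^sub>v v) \<bullet>c v"
    by (rule add_scalar_prod_distrib[of _ n])
      (use S B v in \<open>auto intro!: carrier_vecI simp: mat_adjoint_eq\<close>)
  \<comment> \<open>The column is the adjoint of the row \<open>S\<close>, so it contributes a
    conjugate. For \<open>R = S\<close> the two middle terms are those of
    \<open>complex_quadratic_discriminant\<close> with
    \<open>b = row R 0 \<bullet> v\<close>.\<close>
  moreover have "(mat_adjoint S *\<^sub>v vec 1 (\<lambda>_. z)) \<bullet>c v = z * cnj (row S 0 \<bullet> v)"
    using S v by (simp add: scalar_prod_def mat_adjoint_eq sum_distrib_left ac_simps)
  ultimately show ?thesis by (simp add: algebra_simps)
qed

lemma hermitian_mat_bordered_block: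
  assumes H: "hermitian_mat (n + 1) (bordered_mat a R S B)"
    and R: "R \<in> carrier_mat 1 n" and S: "S \<in> carrier_mat n 1" and B: "B \<in> carrier_mat n n"
  shows "hermitian_mat n B"
proof -
  have "cnj (B $$ (j, i)) = B $$ (i, j)" if ij: "i < n" "j < n" for i j
  proof -
    \<comment> \<open>The scalar corner takes index 0, which shifts the indices of \<open>B\<close>
      by one.\<close>
    have "bordered_mat a R S B $$ (Suc p, Suc q) = B $$ (p, q)" if "p < n" "q < n" for p q
      using that R S B by (simp add: bordered_mat_def)
    moreover have "cnj (bordered_mat a R S B $$ (Suc j, Suc i)) =
        bordered_mat a R S B $$ (Suc i, Suc j)"
      using H ij by (simp add: hermitian_mat_iff)
    ultimately show ?thesis using ij by simp
  qed
  then show ?thesis using B by (simp add: hermitian_mat_iff)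
qed

text \<open>Moving the adjoint across the inner product leaves the squared modulus of the single
  entry of \<open>C *\<^sub>v v\<close>. This lets a discriminant inequality be read as a Loewner
  bound.\<close>

lemma adjoint_mult_row_form:
  assumes C: "C \<in> carrier_mat 1 n" and v: "v \<in> carrier_vec n"
  shows "((mat_adjoint C * C) *\<^sub>v v) \<bullet>c v = (row C 0 \<bullet> v) * cnj (row C 0 \<bullet> v)"
proof -
  have "(mat_adjoint C * C) *\<^sub>v v = mat_adjoint C *\<^sub>v (C *\<^sub>v v)"
    by (rule assoc_mult_mat_vec[of _ n 1 _ n]) (use C v in auto)
  also have "\<dots> \<bullet>c v = (\<Sum>i<n. (row C 0 \<bullet> v) * cnj (C $$ (0, i) * v $ i))"
    using C v by (simp add: scalar_prod_def[of _ "conjugate v"] mat_adjoint_eq atLeast0LessThan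
        scalar_prod_def[of "vec _ _"] ac_simps)
  also have "\<dots> = (row C 0 \<bullet> v) * cnj (row C 0 \<bullet> v)"
    using C v by (simp add: scalar_prod_def[of "row C 0"] atLeast0LessThan sum_distrib_left)
  finally show ?thesis .
qed

lemma hermitian_mat_adjoint_mult_row:
  assumes "C \<in> carrier_mat 1 n"
  shows "hermitian_mat n (mat_adjoint C * C)"
  using assms by (auto simp: hermitian_mat_iff mat_adjoint_eq scalar_prod_def)

lemma hermitian_mat_smult:
  assumes "hermitian_mat n B" "cnj a = a"
  shows "hermitian_mat n (a \<cdot>\<^sub>m B)"
  using assms by (auto simp: hermitian_mat_iff)

lemma hermitian_mat_minus:
  assumes "hermitian_mat n A" "hermitian_mat n B"
  shows "hermitian_mat n (A - B)"
  using assms by (auto simp: hermitian_mat_iff)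

lemma row_mat_eq_zero:
  fixes C :: "complex mat"
  assumes C: "C \<in> carrier_mat 1 n" and zero: "\<And>v. v \<in> carrier_vec n \<Longrightarrow> row C 0 \<bullet> v = 0"
  shows "C = 0\<^sub>m 1 n"
proof (rule eq_matI)
  fix i j assume "i < dim_row (0\<^sub>m 1 n :: complex mat)" "j < dim_col (0\<^sub>m 1 n :: complex mat)"
  then show "C $$ (i, j) = 0\<^sub>m 1 n $$ (i, j)"
    \<comment> \<open>Testing at a standard basis vector reads off one entry of the row.\<close>
    using C zero[of "unit_vec n j"] by simp
qed (use C in auto)

section \<open>Relations between the blocks of the Choi matrix\<close>

theorem proposition2p1:
  fixes n :: nat and \<phi> :: "complex mat \<Rightarrow> complex mat"
    and a x :: complex and B C T U Y Z :: "complex mat"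
  assumes "n \<ge> 1"
    and "positive_linear_map 2 (n + 1) \<phi>"
    and "C \<in> carrier_mat 1 n" and "Y \<in> carrier_mat 1 n" and "Z \<in> carrier_mat 1 n"
    and "B \<in> carrier_mat n n" and "T \<in> carrier_mat n n" and "U \<in> carrier_mat n n"
    and "choi_matrix \<phi> = mat_of_rows_list 2
      [[bordered_mat a C (mat_adjoint C) B, bordered_mat x Y (mat_adjoint Z) T],
       [bordered_mat (cnj x) Z (mat_adjoint Y) (mat_adjoint T),
        bordered_mat 0 (0\<^sub>m 1 n) (0\<^sub>m n 1) U]]"
  shows "(a \<ge> 0 \<and> positive_mat n B \<and> positive_mat n U) \<and>
    ((a = 0 \<longrightarrow> C = 0\<^sub>m 1 n) \<and>
      (a > 0 \<longrightarrow> loewner_le n (mat_adjoint C * C) (a \<cdot>\<^sub>m B))) \<and>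
    x = 0 \<and>
    block_positive n (mat_of_rows_list 2 [[B, T], [mat_adjoint T, U]])"
proof -
  let ?H = "mat_of_rows_list 2
      [[bordered_mat a C (mat_adjoint C) B, bordered_mat x Y (mat_adjoint Z) T],
       [bordered_mat (cnj x) Z (mat_adjoint Y) (mat_adjoint T),
        bordered_mat 0 (0\<^sub>m 1 n) (0\<^sub>m n 1) U]]"
  note pos = assms(2) and C = assms(3) and Y = assms(4) and Z = assms(5)
    and B = assms(6) and T = assms(7) and U = assms(8) and H = assms(9)
  \<comment> \<open>Writing the zero column as an adjoint brings the last Choi block into the shape
    required by \<open>bordered_mat_form\<close>.\<close>
  have zero_adj: "0\<^sub>m n 1 = mat_adjoint (0\<^sub>m 1 n :: complex mat)"
    by (auto simp: mat_adjoint_eq)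
  have zero_row: "row (0\<^sub>m 1 n) 0 \<bullet> v = 0" if "v \<in> carrier_vec n" for v :: "complex vec"
    using that by simp
  define q where "q M v = (M *\<^sub>v v) \<bullet>c v" for M :: "complex mat" and v
  \<comment> \<open>Block-positivity of the Choi matrix at coefficients
    \<open>(\<mu>, \<nu>)\<close> and the vector \<open>(z, v)\<close>, expanded. The last block
    leaves only \<open>q U v\<close>, since its corner and borders vanish.\<close>
  have form: "0 \<le>
      cnj \<mu> * \<mu> * (z * cnj z * a + cnj z * (row C 0 \<bullet> v) + z * cnj (row C 0 \<bullet> v) + q B v) +
      cnj \<mu> * \<nu> * (z * cnj z * x + cnj z * (row Y 0 \<bullet> v) + z * cnj (row Z 0 \<bullet> v) + q T v) +
      cnj \<nu> * \<mu> * (z * cnj z * cnj x + cnj z * (row Z 0 \<bullet> v) + z * cnj (row Y 0 \<bullet> v)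
        + q (mat_adjoint T) v) +
      cnj \<nu> * \<nu> * q U v" if v: "v \<in> carrier_vec n" for \<mu> \<nu> z v
  proof -
    let ?\<mu> = "\<lambda>i :: nat. if i = 0 then \<mu> else \<nu>" and ?\<xi> = "vec 1 (\<lambda>_. z) @\<^sub>v v"
    have \<xi>: "?\<xi> \<in> carrier_vec (n + 1)"
      using append_carrier_vec[OF vec_carrier v] by (simp only: add.commute)
    have bp: "block_positive (n + 1) ?H"
      using block_positive_choi_matrix[OF pos] unfolding H .
    have "0 \<le> (\<Sum>i<2. \<Sum>j<2. cnj (?\<mu> i) * ?\<mu> j * ((?H $$ (i, j) *\<^sub>v ?\<xi>) \<bullet>c ?\<xi>))"
      using bp[unfolded block_positive_def, THEN conjunct2, THEN conjunct2, THEN spec,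
          THEN bspec, OF \<xi>] .
    moreover have "?H $$ (0, 0) = bordered_mat a C (mat_adjoint C) B"
      "?H $$ (0, 1) = bordered_mat x Y (mat_adjoint Z) T"
      "?H $$ (1, 0) = bordered_mat (cnj x) Z (mat_adjoint Y) (mat_adjoint T)"
      "?H $$ (1, 1) = bordered_mat 0 (0\<^sub>m 1 n) (mat_adjoint (0\<^sub>m 1 n)) U"
      unfolding zero_adj by (simp_all add: mat_of_rows_list_def)
    ultimately show ?thesis
      unfolding sum_lessThan_2
      using bordered_mat_form[OF C C B v, of a z] bordered_mat_form[OF Y Z T v, of x z]
        bordered_mat_form[OF Z Y mat_adjoint_carrier[OF T] v, of "cnj x" z]
        bordered_mat_form[OF zero_carrier_mat zero_carrier_mat U v, of 0 z] zero_row[OF v]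
      by (simp add: q_def add.assoc del: One_nat_def)
  qed
  have row0 [simp]: "row M 0 \<bullet> 0\<^sub>v n = 0" if "M \<in> carrier_mat 1 n" for M :: "complex mat"
    using row_carrier_vec[of 0 1 M n] that by simp
  have q0 [simp]: "q M (0\<^sub>v n) = 0" if "M \<in> carrier_mat n n" for M
    using that by (simp add: q_def)
  \<comment> \<open>Positional instantiations of \<open>form\<close> follow the order
    \<open>v\<close>, \<open>\<mu>\<close>, \<open>z\<close>, \<open>\<nu>\<close>. Here
    \<open>v = 0\<close> and \<open>\<nu> = 0\<close> isolate the corner of the first block.\<close>
  have a: "0 \<le> a" using form[of "0\<^sub>v n" 1 1 0] B C by simp
  have qB: "0 \<le> q B v" and qU: "0 \<le> q U v" if "v \<in> carrier_vec n" for v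
    using form[OF that, of 1 0 0] form[OF that, of 0 0 1] by simp_all
  \<comment> \<open>Now the variable is the coefficient \<open>\<mu>\<close>, while the vector is
    fixed at \<open>(1, 0)\<close>. The constant term is the zero corner of the last block, so the
    discriminant bound forces \<open>x = 0\<close>.\<close>
  have "0 \<le> z * cnj z * a + cnj z * x + z * cnj x + 0" for z
    using form[of "0\<^sub>v n" z 1 1] B C Y Z T U by (simp add: algebra_simps)
  from complex_quadratic_discriminant[OF this a] have x: "x = 0"
    by (simp add: less_eq_complex_def complex_eq_iff sum_squares_le_zero_iff)
  \<comment> \<open>With coefficients \<open>(1, 0)\<close> only the first block remains, and the
    variable is the scalar coordinate of the vector.\<close>
  have "0 \<le> z * cnj z * a + cnj z * (row C 0 \<bullet> v) + z * cnj (row C 0 \<bullet> v) + q B v"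
    if "v \<in> carrier_vec n" for z v
    using form[OF that, of 1 z 0] by simp
  from complex_quadratic_discriminant[OF this a]
  have Cv: "(row C 0 \<bullet> v) * cnj (row C 0 \<bullet> v) \<le> a * q B v" if "v \<in> carrier_vec n" for v
    using that by blast
  \<comment> \<open>\<open>form\<close> controls quadratic forms only; the hermitian half of
    \<open>positive_mat\<close> for \<open>B\<close> and \<open>U\<close> is inherited from the
    images of the diagonal matrix units.\<close>
  have "hermitian_mat (n + 1) (choi_matrix \<phi> $$ (i, i))" if "i < 2" for i
    using that pos positive_mat_matrix_unit_diag[OF that]
    by (auto simp: choi_matrix_def positive_linear_map_def positive_mat_def)
  from this[of 0] this[of 1]
  have "hermitian_mat (n + 1) (bordered_mat a C (mat_adjoint C) B)"
    and "hermitian_mat (n + 1) (bordered_mat 0 (0\<^sub>m 1 n) (0\<^sub>m n 1) U)"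
    by (simp_all add: H mat_of_rows_list_def)
  then have hB: "hermitian_mat n B" and hU: "hermitian_mat n U"
    using B C U by (auto intro: hermitian_mat_bordered_block)
  have "C = 0\<^sub>m 1 n" if "a = 0"
  proof (rule row_mat_eq_zero[OF C])
    fix v :: "complex vec" assume "v \<in> carrier_vec n"
    from Cv[OF this] that show "row C 0 \<bullet> v = 0"
      by (simp add: less_eq_complex_def complex_eq_iff sum_squares_le_zero_iff)
  qed
  moreover have "loewner_le n (mat_adjoint C * C) (a \<cdot>\<^sub>m B)"
  proof -
    have "cnj a = a" using a by (auto simp: less_eq_complex_def complex_eq_iff)
    then have h: "hermitian_mat n (a \<cdot>\<^sub>m B)" by (rule hermitian_mat_smult[OF hB])
    \<comment> \<open>The form of the difference at \<open>v\<close> is \<open>a * q B v\<close>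
      minus the squared modulus of \<open>row C 0 \<bullet> v\<close>, so this is \<open>Cv\<close>
      again.\<close>
    have "0 \<le> ((a \<cdot>\<^sub>m B - mat_adjoint C * C) *\<^sub>v v) \<bullet>c v" if v: "v \<in> carrier_vec n" for v
    proof -
      have "((a \<cdot>\<^sub>m B - mat_adjoint C * C) *\<^sub>v v) \<bullet>c v =
          ((a \<cdot>\<^sub>m B) *\<^sub>v v) \<bullet>c v - ((mat_adjoint C * C) *\<^sub>v v) \<bullet>c v"
        using v B C
        by (simp add: minus_mult_distrib_mat_vec[of _ n n] minus_scalar_prod_distrib[of _ n]
            mult_carrier_mat[of _ n 1] mult_mat_vec_carrier[of _ n n])
      also have "\<dots> = a * q B v - (row C 0 \<bullet> v) * cnj (row C 0 \<bullet> v)"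
        using v B by (simp add: adjoint_mult_row_form[OF C v] smult_mat_mult_vec[of _ n n] q_def)
      finally show ?thesis using Cv[OF v] by simp
    qed
    then show ?thesis
      using h hermitian_mat_adjoint_mult_row[OF C] hermitian_mat_minus
      by (auto simp: loewner_le_def positive_mat_def)
  qed
  moreover have "block_positive n (mat_of_rows_list 2 [[B, T], [mat_adjoint T, U]])"
    unfolding block_positive_def
  proof (intro conjI allI impI ballI)
    fix i j :: nat assume "i < 2" "j < 2"
    then show "mat_of_rows_list 2 [[B, T], [mat_adjoint T, U]] $$ (i, j) \<in> carrier_mat n n"
      using B T U by (auto simp: mat_of_rows_list_def less_2_cases_iff)
  next
    fix \<mu> :: "nat \<Rightarrow> complex" and \<xi> :: "complex vec" assume "\<xi> \<in> carrier_vec n"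
    \<comment> \<open>A zero scalar coordinate removes all corners and borders, leaving the form of
      the compression.\<close>
    from form[OF this, of "\<mu> 0" 0 "\<mu> 1"]
    show "0 \<le> (\<Sum>i<2. \<Sum>j<2. cnj (\<mu> i) * \<mu> j *
        ((mat_of_rows_list 2 [[B, T], [mat_adjoint T, U]] $$ (i, j) *\<^sub>v \<xi>) \<bullet>c \<xi>))"
      by (simp add: sum_lessThan_2 mat_of_rows_list_def q_def add.assoc)
  qed (auto simp: mat_of_rows_list_def)
  ultimately show ?thesis
    using a x qB qU hB hU by (auto simp: positive_mat_def q_def)
qed

end
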